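(* Let $|\Theta_n\rangle=\hat a_{n,1}^\dagger\,\hat a_{n,2}^\dagger\cdots|0\rangle$ be multi-particle basis states, each built from single-particle packaged creation operators, all belonging to the same net-charge subspace $\mathcal H_Q$. Consider any superposition $$|\Psi\rangle=\sum_n\alpha_n|\Theta_n\rangle,\qquad |\Theta_n\rangle\in\mathcal H_Q\ \text{for all } n.$$ Then: 1. (Superselection compatibility) $|\Psi\rangle$ is physically realizable with no cross-sector interference: it lies in the single sector $\mathcal H_Q$. Mixing (coherently superposing) states from $\mathcal H_Q$ and $\mathcal H_{Q'}$ with $Q\neq Q'$ is forbidden. 2. (Packaged entangled state) If $|\Psi\rangle$ is non-factorizable over its particles, it is a packaged entangled state. 3. (Gauge covariance) Each $|\Theta_n\rangle$ transforms covariantly under $G$ with total charge $Q$, and any linear combination $|\Psi\rangle$ within the same charge sector also transforms in a well-defined representation of the gauge group $G$. No partial internal quantum numbers can be extracted from a single term: in each term, every creation operator carries its internal quantum numbers as one irreducible block.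
   Context: Setting: a local gauge theory with gauge group $G$ (Abelian or non-Abelian), with Fock space spanned by products of creation operators applied to the vacuum $|0\rangle$; $\hat a^\dagger$ denotes the creation operator of either a particle or an antiparticle. Internal quantum numbers (IQNs) are electric charge, flavor, color, baryon/lepton number, etc. Single-particle packaged operator: a creation operator that transforms as an irreducible representation under gauge transformations, i.e. $U_g\,\hat a^\dagger(\mathbf p,q)\,U_g^{-1}=\sum_{q'}[D_g]_{q'q}\,\hat a^\dagger(\mathbf p,q')$ with $D$ an irreducible representation of $G$, and thereby carries all relevant IQNs as one inseparable block. Net-charge sectors: with $\hat Q$ the self-adjoint charge operator, the Hilbert space decomposes as $\mathcal H=\bigoplus_{Q\in\sigma(\hat Q)}\mathcal H_Q$, where $\mathcal H_Q$ is the subspace of states with net charge $Q$. Superselection rule (assumed): for $Q\ne Q'$, $\mathcal H_Q$ and $\mathcal H_{Q'}$ are disjoint subspaces whose states cannot form physically realizable coherent superpositions; states of different net charge are orthogonal under local gauge-invariant measurements (no gauge-invariant observable has matrix elements between them). Linear combinations within one $\mathcal H_Q$ are allowed. Packaged entangled state: a state $|\Psi\rangle=\sum_n\alpha_n|\Theta_n\rangle$, with $|\Theta_n\rangle=\hat a_{n,1}^\dagger\hat a_{n,2}^\dagger\cdots|0\rangle$, such that (i) each $\hat a_{n,k}^\dagger$ is a single-particle packaged operator; (ii) every $|\Theta_n\rangle$ belongs to the same net-charge subspace $\mathcal H_Q$; (iii) the total wavefunction is non-factorizable across its multiple excitations with respect to internal charges, i.e. it cannot be written as a tensor product across the distinct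 excitations.
   Formalization: The net-charge operator is assumed to commute with all gauge transformations and the vacuum to be gauge-invariant; without the former, claim 3 fails, e.g. for the charge T_3 with G = SU(2), where a gauge transformation moves a product state out of its charge sector. *)

theory Defs
  imports "HOL-Analysis.Analysis" "HOL-Algebra.Group"
begin

section \<open>Complex Hilbert spaces\<close>

text \<open>The inner product is conjugate-linear in the first argument. Norm, topology and completeness
  are those of the underlying real Hilbert space.\<close>

class complex_hilbert_space = real_inner + complete_space +
  fixes scaleC :: "complex \<Rightarrow> 'a \<Rightarrow> 'a" (infixr "*\<^sub>C" 75)
    and cinner :: "'a \<Rightarrow> 'a \<Rightarrow> complex"
  assumes scaleC_add_right: "a *\<^sub>C (x + y) = a *\<^sub>C x + a *\<^sub>C y"
    and scaleC_add_left: "(a + b) *\<^sub>C x = a *\<^sub>C x + b *\<^sub>C x"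
    and scaleC_scaleC: "a *\<^sub>C (b *\<^sub>C x) = (a * b) *\<^sub>C x"
    and scaleC_one: "1 *\<^sub>C x = x"
    and scaleR_scaleC: "r *\<^sub>R x = complex_of_real r *\<^sub>C x"
    and cinner_commute: "cinner x y = cnj (cinner y x)"
    and cinner_add_right: "cinner x (y + z) = cinner x y + cinner x z"
    and cinner_scaleC_right: "cinner x (a *\<^sub>C y) = a * cinner x y"
    and inner_eq_Re_cinner: "inner x y = Re (cinner x y)"

instantiation complex :: complex_hilbert_space
begin

definition scaleC_complex_def: "a *\<^sub>C (z::complex) = a * z"

definition cinner_complex_def: "cinner w (z::complex) = cnj w * z"

instance
  by standard
    (simp_all add: scaleC_complex_def cinner_complex_def algebra_simps inner_complex_def
      scaleR_conv_of_real)

end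

interpretation complex_vector: vector_space
  "scaleC :: complex \<Rightarrow> 'h \<Rightarrow> 'h::complex_hilbert_space"
  by unfold_locales
    (simp_all add: scaleC_add_right scaleC_add_left scaleC_scaleC scaleC_one)

abbreviation csubspace :: "'h::complex_hilbert_space set \<Rightarrow> bool"
  where "csubspace \<equiv> complex_vector.subspace"

abbreviation cspan :: "'h::complex_hilbert_space set \<Rightarrow> 'h set"
  where "cspan \<equiv> complex_vector.span"

definition clinear_on ::
  "'h::complex_hilbert_space set \<Rightarrow> ('h \<Rightarrow> 'h) \<Rightarrow> bool" where
  "clinear_on D A \<longleftrightarrow>
     (\<forall>\<phi>\<in>D. \<forall>\<psi>\<in>D. A (\<phi> + \<psi>) = A \<phi> + A \<psi>) \<and>
     (\<forall>c. \<forall>\<phi>\<in>D. A (c *\<^sub>C \<phi>) = c *\<^sub>C A \<phi>)"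

definition unitary_operator :: "('h::complex_hilbert_space \<Rightarrow> 'h) \<Rightarrow> bool" where
  "unitary_operator V \<longleftrightarrow>
     clinear_on UNIV V \<and> surj V \<and> (\<forall>\<phi> \<psi>. cinner (V \<phi>) (V \<psi>) = cinner \<phi> \<psi>)"

text \<open>A possibly unbounded operator is a pair of a domain \<open>D\<close> and a function \<open>A\<close> whose values off
  \<open>D\<close> are irrelevant. The last conjunct says that the graph of the adjoint of \<open>A\<close> is the graph of
  \<open>A\<close>.\<close>

definition self_adjoint_on ::
  "'h::complex_hilbert_space set \<Rightarrow> ('h \<Rightarrow> 'h) \<Rightarrow> bool" where
  "self_adjoint_on D A \<longleftrightarrow>
     csubspace D \<and> closure D = UNIV \<and> clinear_on D A \<and>
     (\<forall>\<phi> \<xi>. (\<forall>\<psi>\<in>D. cinner \<phi> (A \<psi>) = cinner \<xi> \<psi>) \<longleftrightarrow> \<phi> \<in> D \<and> \<xi> = A \<phi>)"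

definition op_spectrum ::
  "'h::complex_hilbert_space set \<Rightarrow> ('h \<Rightarrow> 'h) \<Rightarrow> complex set" where
  "op_spectrum D A =
     {z. \<not> (\<exists>R. clinear_on UNIV R \<and> bounded_linear R \<and>
               (\<forall>\<phi>. R \<phi> \<in> D \<and> A (R \<phi>) - z *\<^sub>C R \<phi> = \<phi>) \<and>
               (\<forall>\<psi>\<in>D. R (A \<psi> - z *\<^sub>C \<psi>) = \<psi>))}"

definition hilbert_direct_sum ::
  "'i set \<Rightarrow> ('i \<Rightarrow> 'h::complex_hilbert_space set) \<Rightarrow> bool" where
  "hilbert_direct_sum I S \<longleftrightarrow>
     (\<forall>i\<in>I. csubspace (S i) \<and> closed (S i)) \<and>
     (\<forall>i\<in>I. \<forall>j\<in>I. i \<noteq> j \<longrightarrow> (\<forall>\<phi>\<in>S i. \<forall>\<psi>\<in>S j. cinner \<phi> \<psi> = 0)) \<and>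
     closure (cspan (\<Union>i\<in>I. S i)) = UNIV"

definition representation_on ::
  "'g monoid \<Rightarrow> ('g \<Rightarrow> 'h \<Rightarrow> 'h) \<Rightarrow> 'h::complex_hilbert_space set \<Rightarrow> bool" where
  "representation_on G \<rho> V \<longleftrightarrow>
     csubspace V \<and>
     (\<forall>g\<in>carrier G. clinear_on V (\<rho> g) \<and> \<rho> g ` V \<subseteq> V) \<and>
     (\<forall>\<psi>\<in>V. \<rho> \<one>\<^bsub>G\<^esub> \<psi> = \<psi>) \<and>
     (\<forall>g\<in>carrier G. \<forall>h\<in>carrier G. \<forall>\<psi>\<in>V. \<rho> (g \<otimes>\<^bsub>G\<^esub> h) \<psi> = \<rho> g (\<rho> h \<psi>))"


section \<open>Irreducible matrix representations\<close>

text \<open>Matrices are indexed by a finite set \<open>B\<close>; the representation space \<open>\<complex>\<^sup>B\<close> consists of the functions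
  vanishing off \<open>B\<close>.\<close>

definition coord_space :: "'q set \<Rightarrow> ('q \<Rightarrow> complex) set" where
  "coord_space B = {v. \<forall>i. i \<notin> B \<longrightarrow> v i = 0}"

definition mat_apply :: "'q set \<Rightarrow> ('q \<Rightarrow> 'q \<Rightarrow> complex) \<Rightarrow> ('q \<Rightarrow> complex) \<Rightarrow> 'q \<Rightarrow> complex" where
  "mat_apply B A v = (\<lambda>i. if i \<in> B then \<Sum>j\<in>B. A i j * v j else 0)"

definition coord_subspace :: "('q \<Rightarrow> complex) set \<Rightarrow> bool" where
  "coord_subspace W \<longleftrightarrow>
     (\<lambda>i. 0) \<in> W \<and>
     (\<forall>v\<in>W. \<forall>w\<in>W. (\<lambda>i. v i + w i) \<in> W) \<and>
     (\<forall>c. \<forall>v\<in>W. (\<lambda>i. c * v i) \<in> W)"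

definition matrix_representation ::
  "'g monoid \<Rightarrow> 'q set \<Rightarrow> ('g \<Rightarrow> 'q \<Rightarrow> 'q \<Rightarrow> complex) \<Rightarrow> bool" where
  "matrix_representation G B D \<longleftrightarrow>
     (\<forall>i\<in>B. \<forall>j\<in>B. D \<one>\<^bsub>G\<^esub> i j = (if i = j then 1 else 0)) \<and>
     (\<forall>g\<in>carrier G. \<forall>h\<in>carrier G. \<forall>i\<in>B. \<forall>j\<in>B.
        D (g \<otimes>\<^bsub>G\<^esub> h) i j = (\<Sum>k\<in>B. D g i k * D h k j))"

definition irreducible_representation ::
  "'g monoid \<Rightarrow> 'q set \<Rightarrow> ('g \<Rightarrow> 'q \<Rightarrow> 'q \<Rightarrow> complex) \<Rightarrow> bool" where
  "irreducible_representation G B D \<longleftrightarrow>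
     finite B \<and> B \<noteq> {} \<and> matrix_representation G B D \<and>
     (\<forall>W. W \<subseteq> coord_space B \<and> coord_subspace W \<and>
          (\<forall>g\<in>carrier G. \<forall>v\<in>W. mat_apply B (D g) v \<in> W)
        \<longrightarrow> W = {\<lambda>i. 0} \<or> W = coord_space B)"


section \<open>Gauge theory on Fock space\<close>

text \<open>A creation operator is labelled by \<open>(s, p, q)\<close>: \<open>s\<close> is a particle or antiparticle species, \<open>p\<close>
  an external one-particle mode (a discrete momentum or a wave packet, so that the operators are
  genuine), and \<open>q\<close>, ranging over \<open>iqn M s\<close>, an internal state of the species. Fixed internal
  quantum numbers such as flavour are part of \<open>s\<close>.\<close>

record ('g, 'h, 's, 'p, 'q) gauge_fock =
  gauge_group :: "'g monoid"
  gauge_op :: "'g \<Rightarrow> 'h \<Rightarrow> 'h"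
  charge_dom :: "'h set"
  charge :: "'h \<Rightarrow> 'h"
  vacuum :: 'h
  iqn :: "'s \<Rightarrow> 'q set"
  create :: "'s \<times> 'p \<times> 'q \<Rightarrow> 'h \<Rightarrow> 'h"
  annihilate :: "'s \<times> 'p \<times> 'q \<Rightarrow> 'h \<Rightarrow> 'h"
  fermionic :: "'s \<Rightarrow> bool"

definition labels :: "('g, 'h, 's, 'p, 'q) gauge_fock \<Rightarrow> ('s \<times> 'p \<times> 'q) set" where
  "labels M = {(s, p, q). q \<in> iqn M s}"

definition fock_state :: "('g, 'h, 's, 'p, 'q) gauge_fock \<Rightarrow> ('s \<times> 'p \<times> 'q) list \<Rightarrow> 'h" where
  "fock_state M xs = foldr (create M) xs (vacuum M)"

text \<open>The common invariant domain of the (in general unbounded) creation operators.\<close>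

definition fock_core ::
  "('g, 'h::complex_hilbert_space, 's, 'p, 'q) gauge_fock \<Rightarrow> 'h set" where
  "fock_core M = cspan {fock_state M xs | xs. set xs \<subseteq> labels M}"

definition exchange_sign ::
  "('g, 'h, 's, 'p, 'q) gauge_fock \<Rightarrow> 's \<times> 'p \<times> 'q \<Rightarrow> 's \<times> 'p \<times> 'q \<Rightarrow> complex" where
  "exchange_sign M x y = (if fermionic M (fst x) \<and> fermionic M (fst y) then - 1 else 1)"

definition sector ::
  "('g, 'h::complex_hilbert_space, 's, 'p, 'q) gauge_fock \<Rightarrow> real \<Rightarrow> 'h set" where
  "sector M Q = {\<psi> \<in> charge_dom M. charge M \<psi> = complex_of_real Q *\<^sub>C \<psi>}"

definition gauge_invariant_observable ::
  "('g, 'h::complex_hilbert_space, 's, 'p, 'q) gauge_fock \<Rightarrow> 'h set \<Rightarrow> ('h \<Rightarrow> 'h) \<Rightarrow> bool" where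
  "gauge_invariant_observable M D A \<longleftrightarrow>
     self_adjoint_on D A \<and>
     (\<forall>g\<in>carrier (gauge_group M). \<forall>\<psi>\<in>D.
        gauge_op M g \<psi> \<in> D \<and> A (gauge_op M g \<psi>) = gauge_op M g (A \<psi>))"

definition interferes ::
  "('g, 'h::complex_hilbert_space, 's, 'p, 'q) gauge_fock \<Rightarrow> 'h \<Rightarrow> 'h \<Rightarrow> bool" where
  "interferes M \<phi> \<psi> \<longleftrightarrow>
     (\<exists>D A. gauge_invariant_observable M D A \<and> \<psi> \<in> D \<and> cinner \<phi> (A \<psi>) \<noteq> 0)"

definition superselection_rule ::
  "('g, 'h::complex_hilbert_space, 's, 'p, 'q) gauge_fock \<Rightarrow> bool" where
  "superselection_rule M \<longleftrightarrow>
     (\<forall>Q Q'. Q \<noteq> Q' \<longrightarrow> (\<forall>\<phi>\<in>sector M Q. \<forall>\<psi>\<in>sector M Q'. \<not> interferes M \<phi> \<psi>))"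

text \<open>In the (anti)commutator of an annihilation with a creation operator, \<open>\<kappa>\<close> is the overlap of the
  two one-particle states; it is \<open>\<delta>\<close> for orthonormal modes. Gauge invariance of \<open>fock_core\<close> makes
  \<open>U\<^sub>g a\<^sup>\<dagger> U\<^sub>g\<^sup>-\<^sup>1\<close> meaningful on it. Gauge invariance of the net charge means that a charge multiplet
  lies in a single sector; it would fail for a generator such as \<open>T\<^sub>3\<close> of a non-Abelian group.\<close>

definition gauge_fock_space ::
  "('g, 'h::complex_hilbert_space, 's, 'p, 'q) gauge_fock \<Rightarrow> bool" where
  "gauge_fock_space M \<longleftrightarrow>
     group (gauge_group M) \<and>
     (\<forall>g\<in>carrier (gauge_group M). unitary_operator (gauge_op M g)) \<and>
     representation_on (gauge_group M) (gauge_op M) UNIV \<and>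
     norm (vacuum M) = 1 \<and>
     closure (fock_core M) = UNIV \<and>
     (\<forall>x\<in>labels M. clinear_on (fock_core M) (create M x) \<and>
        annihilate M x ` fock_core M \<subseteq> fock_core M \<and>
        annihilate M x (vacuum M) = 0 \<and>
        (\<forall>\<phi>\<in>fock_core M. \<forall>\<psi>\<in>fock_core M.
           cinner (create M x \<phi>) \<psi> = cinner \<phi> (annihilate M x \<psi>))) \<and>
     (\<forall>x\<in>labels M. \<forall>y\<in>labels M.
        (\<forall>\<phi>\<in>fock_core M.
           create M x (create M y \<phi>) = exchange_sign M x y *\<^sub>C create M y (create M x \<phi>)) \<and>
        (\<exists>\<kappa>. \<forall>\<phi>\<in>fock_core M.
           annihilate M x (create M y \<phi>) =
             exchange_sign M x y *\<^sub>C create M y (annihilate M x \<phi>) + \<kappa> *\<^sub>C \<phi>)) \<and>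
     (\<forall>g\<in>carrier (gauge_group M).
        gauge_op M g (vacuum M) = vacuum M \<and> gauge_op M g ` fock_core M \<subseteq> fock_core M) \<and>
     gauge_invariant_observable M (charge_dom M) (charge M) \<and>
     hilbert_direct_sum
       {Q. complex_of_real Q \<in> op_spectrum (charge_dom M) (charge M)} (sector M) \<and>
     superselection_rule M"


section \<open>Physically realizable states\<close>

definition is_charge_component ::
  "('g, 'h::complex_hilbert_space, 's, 'p, 'q) gauge_fock \<Rightarrow> real \<Rightarrow> 'h \<Rightarrow> 'h \<Rightarrow> bool" where
  "is_charge_component M Q \<psi> \<phi> \<longleftrightarrow>
     \<phi> \<in> sector M Q \<and> (\<forall>\<xi>\<in>sector M Q. cinner \<xi> (\<psi> - \<phi>) = 0)"

text \<open>A vector is realizable as a coherent superposition of its charge components if the relative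
  phase of any two of them that are nonzero shows up in some gauge-invariant measurement.\<close>

definition physically_realizable ::
  "('g, 'h::complex_hilbert_space, 's, 'p, 'q) gauge_fock \<Rightarrow> 'h \<Rightarrow> bool" where
  "physically_realizable M \<psi> \<longleftrightarrow>
     \<psi> \<noteq> 0 \<and>
     (\<forall>Q Q' \<phi> \<phi>'. Q \<noteq> Q' \<and> is_charge_component M Q \<psi> \<phi> \<and> is_charge_component M Q' \<psi> \<phi>' \<and>
        \<phi> \<noteq> 0 \<and> \<phi>' \<noteq> 0 \<longrightarrow> interferes M \<phi> \<phi>')"


section \<open>Packaged operators and packaged entanglement\<close>

definition transforms_irreducibly ::
  "('g, 'h::complex_hilbert_space, 's, 'p, 'q) gauge_fock \<Rightarrow> 's \<Rightarrow> 'p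
     \<Rightarrow> ('g \<Rightarrow> 'q \<Rightarrow> 'q \<Rightarrow> complex) \<Rightarrow> bool" where
  "transforms_irreducibly M s p D \<longleftrightarrow>
     irreducible_representation (gauge_group M) (iqn M s) D \<and>
     (\<forall>g\<in>carrier (gauge_group M). \<forall>q\<in>iqn M s. \<forall>\<phi>\<in>fock_core M.
        gauge_op M g (create M (s, p, q) (gauge_op M (inv\<^bsub>gauge_group M\<^esub> g) \<phi>)) =
          (\<Sum>q'\<in>iqn M s. D g q' q *\<^sub>C create M (s, p, q') \<phi>))"

definition packaged_operator ::
  "('g, 'h::complex_hilbert_space, 's, 'p, 'q) gauge_fock \<Rightarrow> 's \<times> 'p \<times> 'q \<Rightarrow> bool" where
  "packaged_operator M x \<longleftrightarrow>
     x \<in> labels M \<and> (\<exists>D. transforms_irreducibly M (fst x) (fst (snd x)) D)"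

definition packaged_basis_state ::
  "('g, 'h::complex_hilbert_space, 's, 'p, 'q) gauge_fock \<Rightarrow> real
     \<Rightarrow> ('s \<times> 'p \<times> 'q) list \<Rightarrow> bool" where
  "packaged_basis_state M Q xs \<longleftrightarrow>
     2 \<le> length xs \<and> (\<forall>x\<in>set xs. packaged_operator M x) \<and> fock_state M xs \<in> sector M Q"

text \<open>A state factorizes over its excitations if its wavefunction is a tensor product of one-particle
  wavefunctions \<open>c 0, \<dots>, c (N - 1)\<close>. If these have finite support, the state is
  \<open>A\<^sub>0 A\<^sub>1 \<cdots> |0\<rangle>\<close> for the one-particle creation operators \<open>A\<^sub>k = (\<Sum>x. c k x a\<^sub>x\<^sup>\<dagger>)\<close>.\<close>

definition factorizable ::
  "('g, 'h::complex_hilbert_space, 's, 'p, 'q) gauge_fock \<Rightarrow> 'h \<Rightarrow> bool" where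
  "factorizable M \<psi> \<longleftrightarrow>
     (\<exists>N (c :: nat \<Rightarrow> 's \<times> 'p \<times> 'q \<Rightarrow> complex).
        ((\<lambda>xs. (\<Prod>k<N. c k (xs ! k)) *\<^sub>C fock_state M xs) has_sum \<psi>)
          {xs. length xs = N \<and> set xs \<subseteq> labels M})"

definition packaged_entangled ::
  "('g, 'h::complex_hilbert_space, 's, 'p, 'q) gauge_fock \<Rightarrow> 'h \<Rightarrow> bool" where
  "packaged_entangled M \<psi> \<longleftrightarrow>
     (\<exists>Q (I :: nat set) \<alpha> xs.
        (\<forall>n\<in>I. packaged_basis_state M Q (xs n)) \<and>
        ((\<lambda>n. \<alpha> n *\<^sub>C fock_state M (xs n)) has_sum \<psi>) I) \<and>
     \<not> factorizable M \<psi>"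


section \<open>Gauge covariance\<close>

text \<open>The list \<open>qs\<close> runs over all internal states of the multiplets that the operators in \<open>xs\<close> belong
  to.\<close>

definition transforms_covariantly ::
  "('g, 'h::complex_hilbert_space, 's, 'p, 'q) gauge_fock \<Rightarrow> ('s \<times> 'p \<times> 'q) list \<Rightarrow> bool" where
  "transforms_covariantly M xs \<longleftrightarrow>
     (\<exists>D :: nat \<Rightarrow> 'g \<Rightarrow> 'q \<Rightarrow> 'q \<Rightarrow> complex.
        (\<forall>k<length xs. transforms_irreducibly M (fst (xs ! k)) (fst (snd (xs ! k))) (D k)) \<and>
        (\<forall>g\<in>carrier (gauge_group M).
           gauge_op M g (fock_state M xs) =
             (\<Sum>qs\<in>listset (map (\<lambda>x. iqn M (fst x)) xs).
                (\<Prod>k<length xs. D k g (qs ! k) (snd (snd (xs ! k)))) *\<^sub>C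
                fock_state M (map2 (\<lambda>(s, p, _) q. (s, p, q)) xs qs))))"

text \<open>Operators are taken as extensional functions on \<open>fock_core M\<close>, so that equality of functions is
  equality of operators. A block is indivisible if no part of it strictly between \<open>0\<close> and the whole
  is closed under \<open>A \<mapsto> U\<^sub>g A U\<^sub>g\<^sup>-\<^sup>1\<close>, that is, carries quantum numbers of its own.\<close>

definition block_op ::
  "('g, 'h::complex_hilbert_space, 's, 'p, 'q) gauge_fock \<Rightarrow> 's \<Rightarrow> 'p
     \<Rightarrow> ('q \<Rightarrow> complex) \<Rightarrow> 'h \<Rightarrow> 'h" where
  "block_op M s p c = (\<lambda>\<phi>\<in>fock_core M. \<Sum>q\<in>iqn M s. c q *\<^sub>C create M (s, p, q) \<phi>)"

definition op_subspace ::
  "('g, 'h::complex_hilbert_space, 's, 'p, 'q) gauge_fock \<Rightarrow> ('h \<Rightarrow> 'h) set \<Rightarrow> bool" where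
  "op_subspace M W \<longleftrightarrow>
     (\<lambda>\<phi>\<in>fock_core M. 0) \<in> W \<and>
     (\<forall>A\<in>W. \<forall>B\<in>W. (\<lambda>\<phi>\<in>fock_core M. A \<phi> + B \<phi>) \<in> W) \<and>
     (\<forall>c. \<forall>A\<in>W. (\<lambda>\<phi>\<in>fock_core M. c *\<^sub>C A \<phi>) \<in> W)"

definition indivisible_block ::
  "('g, 'h::complex_hilbert_space, 's, 'p, 'q) gauge_fock \<Rightarrow> 's \<Rightarrow> 'p \<Rightarrow> bool" where
  "indivisible_block M s p \<longleftrightarrow>
     (\<forall>W. W \<subseteq> range (block_op M s p) \<and> op_subspace M W \<and>
          (\<forall>g\<in>carrier (gauge_group M). \<forall>A\<in>W.
             (\<lambda>\<phi>\<in>fock_core M.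
                gauge_op M g (A (gauge_op M (inv\<^bsub>gauge_group M\<^esub> g) \<phi>))) \<in> W)
        \<longrightarrow> W = {\<lambda>\<phi>\<in>fock_core M. 0} \<or> W = range (block_op M s p))"

end

(* Self-adjointness makes every eigenspace of the charge a closed subspace and distinct eigenspaces
   orthogonal; hence a superposition within one sector stays there, and its only nonzero charge
   component is the one of that sector. Covariance of a product of creation operators follows by
   inserting U(g)\<inverse> U(g) between consecutive factors. A block of operators is the image of the
   representation space under a linear intertwiner, so it inherits irreducibility. *)

theory Submission
  imports Defs
begin

section \<open>Complex inner products, linear maps on a domain, and sums in closed subspaces\<close>

section \<open>Complex Hilbert spaces\<close>

lemma cinner_scaleC_left: "cinner (a *\<^sub>C x) y = cnj a * cinner x y"
  by (metis cinner_commute cinner_scaleC_right complex_cnj_mult)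

lemma cinner_zero_right [simp]: "cinner x 0 = 0"
  using cinner_scaleC_right[of x 0 0] by simp

lemma cinner_minus_right: "cinner x (- y) = - cinner x y"
  using cinner_scaleC_right[of x "- 1" y] by simp

lemma cinner_diff_right: "cinner x (y - z) = cinner x y - cinner x z"
  by (metis cinner_add_right cinner_minus_right diff_conv_add_uminus)

lemma cinner_self_eq_0: "cinner x x = 0 \<Longrightarrow> x = 0"
  by (metis inner_eq_Re_cinner inner_eq_zero_iff zero_complex.sel(1))

text \<open>Since \<open>cinner x ((- \<i>) *\<^sub>C y) = - \<i> * cinner x y\<close>, the
  imaginary part is again a real inner product. Continuity of \<open>cinner\<close> thus reduces to
  that of \<open>inner\<close>.\<close>

lemma cinner_conv_inner:
  "cinner x y = of_real (inner x y) + \<i> * of_real (inner x ((- \<i>) *\<^sub>C y))"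
  \<comment> \<open>The deleted rule would pull the minus sign out of the scalar
    \<open>- \<i>\<close>.\<close>
  by (simp add: complex_eq_iff inner_eq_Re_cinner cinner_scaleC_right del: complex_vector.scale_minus_left)

lemma continuous_on_cinner_left: "continuous_on S (\<lambda>x. cinner x y)"
  unfolding cinner_conv_inner by (intro continuous_intros)

lemma clinear_on_zero:
  assumes "clinear_on D A" "\<phi> \<in> D"
  shows "A 0 = 0"
  using assms unfolding clinear_on_def by (metis complex_vector.scale_zero_left)

text \<open>Additivity is known only on \<open>D\<close>, so the subspace property is what keeps the
  partial sums in reach. The weighted form matches expansions in matrix coefficients.\<close>

lemma clinear_on_sum:
  assumes A: "clinear_on D A" and D: "csubspace D"
    and "finite F" and "\<And>i. i \<in> F \<Longrightarrow> f i \<in> D"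
  shows "A (\<Sum>i\<in>F. c i *\<^sub>C f i) = (\<Sum>i\<in>F. c i *\<^sub>C A (f i))"
  using assms(3,4)
proof (induction F rule: finite_induct)
  case empty
  show ?case using clinear_on_zero[OF A complex_vector.subspace_0[OF D]] by simp
next
  case (insert i F)
  have "c i *\<^sub>C f i \<in> D" "(\<Sum>i\<in>F. c i *\<^sub>C f i) \<in> D"
    using insert.prems
    by (auto intro!: complex_vector.subspace_sum[OF D] complex_vector.subspace_scale[OF D])
  then show ?case
    using A insert by (simp add: clinear_on_def)
qed

text \<open>Preserving \<open>cinner\<close> means preserving the norm. Boundedness lets gauge
  transformations pass through infinite sums.\<close>

lemma unitary_operator_bounded_linear:
  assumes "unitary_operator V"
  shows "bounded_linear V"
proof (rule bounded_linear_intro)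
  show "V (x + y) = V x + V y" for x y
    using assms by (simp add: unitary_operator_def clinear_on_def)
  show "V (r *\<^sub>R x) = r *\<^sub>R V x" for r x
    using assms by (simp add: unitary_operator_def clinear_on_def scaleR_scaleC)
  show "norm (V x) \<le> norm x * 1" for x
    using assms by (simp add: unitary_operator_def norm_eq_sqrt_inner inner_eq_Re_cinner)
qed

text \<open>The sum is the limit of finite partial sums, each of which lies in
  \<open>S\<close>.\<close>

lemma has_sum_in_closed_csubspace:
  assumes S: "csubspace S" "closed S"
    and "(f has_sum a) I" and "\<And>i. i \<in> I \<Longrightarrow> f i \<in> S"
  shows "a \<in> S"
proof (rule Lim_in_closed_set[OF S(2)])
  show "(sum f \<longlongrightarrow> a) (finite_subsets_at_top I)"
    using assms(3) by (simp add: has_sum_def)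
  show "\<forall>\<^sub>F F in finite_subsets_at_top I. sum f F \<in> S"
    using assms(4) by (intro eventually_finite_subsets_at_top_weakI
        complex_vector.subspace_sum[OF S(1)]) auto
qed simp

text \<open>The adjoint-graph equivalence, read from right to left with \<xi> = A \<phi>.\<close>

lemma self_adjoint_on_symmetric:
  assumes "self_adjoint_on D A" "\<phi> \<in> D" "\<psi> \<in> D"
  shows "cinner \<phi> (A \<psi>) = cinner (A \<phi>) \<psi>"
  using assms unfolding self_adjoint_on_def by blast


section \<open>Eigenspaces of the self-adjoint charge, charge components and realizability\<close>

section \<open>Charge sectors\<close>

lemma gauge_fock_space_self_adjoint:
  "gauge_fock_space M \<Longrightarrow> self_adjoint_on (charge_dom M) (charge M)"
  by (simp add: gauge_fock_space_def gauge_invariant_observable_def)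

text \<open>Self-adjointness turns the eigenvalue equation, domain membership included, into weak
  equations that are continuous in \<psi>. Closedness of the sector follows even if the charge is
  unbounded.\<close>

lemma sector_conv_adjoint:
  assumes "self_adjoint_on (charge_dom M) (charge M)"
  shows "sector M Q =
    (\<Inter>\<eta>\<in>charge_dom M. {\<psi>. cinner \<psi> (charge M \<eta>) = of_real Q * cinner \<psi> \<eta>})"
proof -
  \<comment> \<open>The adjoint-graph condition at \<xi> = Q \<psi>; as \<open>Q\<close> is real, it
    leaves the first argument of \<open>cinner\<close> unconjugated.\<close>
  have "(\<forall>\<eta>\<in>charge_dom M. cinner \<psi> (charge M \<eta>) = cinner (of_real Q *\<^sub>C \<psi>) \<eta>)
      \<longleftrightarrow> \<psi> \<in> charge_dom M \<and> of_real Q *\<^sub>C \<psi> = charge M \<psi>" for \<psi>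
    using assms unfolding self_adjoint_on_def by blast
  then show ?thesis
    by (simp add: sector_def set_eq_iff cinner_scaleC_left eq_commute[of "charge M _"])
qed

lemma closed_sector:
  assumes "self_adjoint_on (charge_dom M) (charge M)"
  shows "closed (sector M Q)"
  unfolding sector_conv_adjoint[OF assms]
  by (intro closed_INT ballI closed_Collect_eq continuous_intros continuous_on_cinner_left)

lemma csubspace_sector:
  assumes "self_adjoint_on (charge_dom M) (charge M)"
  shows "csubspace (sector M Q)"
proof -
  have D: "csubspace (charge_dom M)" and A: "clinear_on (charge_dom M) (charge M)"
    using assms by (auto simp: self_adjoint_on_def)
  show ?thesis
  proof (rule complex_vector.subspaceI)
    show "0 \<in> sector M Q"
      using clinear_on_zero[OF A] complex_vector.subspace_0[OF D] by (simp add: sector_def)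
    show "x + y \<in> sector M Q" if "x \<in> sector M Q" "y \<in> sector M Q" for x y
      using that A complex_vector.subspace_add[OF D]
      by (simp add: sector_def clinear_on_def scaleC_add_right)
    show "c *\<^sub>C x \<in> sector M Q" if "x \<in> sector M Q" for c x
      using that A complex_vector.subspace_scale[OF D]
      by (simp add: sector_def clinear_on_def mult.commute)
  qed
qed

text \<open>Moving the charge across the inner product multiplies it by \<open>Q'\<close> on one
  side and by \<open>Q\<close> on the other.\<close>

lemma sector_orthogonal:
  assumes "self_adjoint_on (charge_dom M) (charge M)"
    and "\<phi> \<in> sector M Q" "\<psi> \<in> sector M Q'" "Q \<noteq> Q'"
  shows "cinner \<phi> \<psi> = 0"
proof -
  have "cinner \<phi> (charge M \<psi>) = cinner (charge M \<phi>) \<psi>"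
    using assms by (intro self_adjoint_on_symmetric) (auto simp: sector_def)
  then have "of_real Q' * cinner \<phi> \<psi> = of_real Q * cinner \<phi> \<psi>"
    using assms(2,3) by (simp add: sector_def cinner_scaleC_right cinner_scaleC_left)
  then show ?thesis using assms(4) by simp
qed

text \<open>Testing the component against itself gives <\<phi>, \<psi>> = <\<phi>, \<phi>>, and the
  left side vanishes by orthogonality of sectors.\<close>

lemma is_charge_component_of_other_sector:
  assumes "self_adjoint_on (charge_dom M) (charge M)"
    and "\<psi> \<in> sector M Q" "is_charge_component M Q' \<psi> \<phi>" "Q' \<noteq> Q"
  shows "\<phi> = 0"
proof -
  have \<phi>: "\<phi> \<in> sector M Q'" and "cinner \<phi> (\<psi> - \<phi>) = 0"
    using assms(3) by (auto simp: is_charge_component_def)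
  then have "cinner \<phi> \<phi> = 0"
    using sector_orthogonal[OF assms(1) \<phi> assms(2,4)] by (simp add: cinner_diff_right)
  then show ?thesis by (rule cinner_self_eq_0)
qed

lemma is_charge_component_add:
  assumes "self_adjoint_on (charge_dom M) (charge M)"
    and "\<phi> \<in> sector M Q" "\<phi>' \<in> sector M Q'" "Q \<noteq> Q'"
  shows "is_charge_component M Q (\<phi> + \<phi>') \<phi>"
  using assms by (auto simp: is_charge_component_def intro: sector_orthogonal)

text \<open>Of two distinct charges at least one differs from \<open>Q\<close>, and its component is
  zero; the interference requirement holds vacuously.\<close>

lemma physically_realizable_sector:
  assumes "self_adjoint_on (charge_dom M) (charge M)" "\<psi> \<in> sector M Q" "\<psi> \<noteq> 0"
  shows "physically_realizable M \<psi>"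
  using assms is_charge_component_of_other_sector unfolding physically_realizable_def by blast

lemma not_interferes_sectors:
  assumes "gauge_fock_space M" "\<phi> \<in> sector M Q" "\<psi> \<in> sector M Q'" "Q \<noteq> Q'"
  shows "\<not> interferes M \<phi> \<psi>"
  using assms unfolding gauge_fock_space_def superselection_rule_def by blast

text \<open>The two summands are themselves nonzero charge components, so realizability would demand
  the interference that the superselection rule excludes.\<close>

lemma not_physically_realizable_mixture:
  assumes M: "gauge_fock_space M"
    and \<phi>: "\<phi> \<in> sector M Q" "\<phi> \<noteq> 0" and \<phi>': "\<phi>' \<in> sector M Q'" "\<phi>' \<noteq> 0" and "Q \<noteq> Q'"
  shows "\<not> physically_realizable M (\<phi> + \<phi>')"
proof
  note sa = gauge_fock_space_self_adjoint[OF M]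
  assume "physically_realizable M (\<phi> + \<phi>')"
  moreover have "is_charge_component M Q (\<phi> + \<phi>') \<phi>"
    using is_charge_component_add[OF sa] assms by blast
  moreover have "is_charge_component M Q' (\<phi> + \<phi>') \<phi>'"
    using is_charge_component_add[OF sa \<phi>'(1) \<phi>(1)] \<open>Q \<noteq> Q'\<close> by (simp add: add.commute)
  ultimately have "interferes M \<phi> \<phi>'"
    using \<phi>(2) \<phi>'(2) \<open>Q \<noteq> Q'\<close> unfolding physically_realizable_def by blast
  then show False
    using not_interferes_sectors[OF M \<phi>(1) \<phi>'(1) \<open>Q \<noteq> Q'\<close>] by blast
qed


section \<open>The unitary gauge representation on the Fock core, on sectors and on orbit
  spans\<close>

section \<open>Gauge transformations\<close>

lemma csubspace_fock_core: "csubspace (fock_core M)"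
  by (simp add: fock_core_def)

lemma fock_state_in_fock_core: "set xs \<subseteq> labels M \<Longrightarrow> fock_state M xs \<in> fock_core M"
  unfolding fock_core_def by (intro complex_vector.span_base) blast

lemma gauge_op_unitary:
  "gauge_fock_space M \<Longrightarrow> g \<in> carrier (gauge_group M) \<Longrightarrow> unitary_operator (gauge_op M g)"
  by (simp add: gauge_fock_space_def)

lemma gauge_op_clinear:
  "gauge_fock_space M \<Longrightarrow> g \<in> carrier (gauge_group M) \<Longrightarrow> clinear_on UNIV (gauge_op M g)"
  by (simp add: gauge_fock_space_def unitary_operator_def)

lemma gauge_op_sum:
  assumes "gauge_fock_space M" "g \<in> carrier (gauge_group M)" "finite F"
  shows "gauge_op M g (\<Sum>i\<in>F. c i *\<^sub>C f i) = (\<Sum>i\<in>F. c i *\<^sub>C gauge_op M g (f i))"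
  using clinear_on_sum[OF gauge_op_clinear[OF assms(1,2)] _ assms(3)]
  by (simp add: complex_vector.subspace_UNIV)

lemma gauge_op_fock_core:
  "gauge_fock_space M \<Longrightarrow> g \<in> carrier (gauge_group M) \<Longrightarrow> \<phi> \<in> fock_core M
    \<Longrightarrow> gauge_op M g \<phi> \<in> fock_core M"
  unfolding gauge_fock_space_def by blast

lemma gauge_fock_space_group: "gauge_fock_space M \<Longrightarrow> group (gauge_group M)"
  by (simp add: gauge_fock_space_def)

lemma gauge_op_one: "gauge_fock_space M \<Longrightarrow> gauge_op M \<one>\<^bsub>gauge_group M\<^esub> \<psi> = \<psi>"
  by (simp add: gauge_fock_space_def representation_on_def)

lemma gauge_op_mult:
  "gauge_fock_space M \<Longrightarrow> g \<in> carrier (gauge_group M) \<Longrightarrow> h \<in> carrier (gauge_group M)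
    \<Longrightarrow> gauge_op M (g \<otimes>\<^bsub>gauge_group M\<^esub> h) \<psi> = gauge_op M g (gauge_op M h \<psi>)"
  by (simp add: gauge_fock_space_def representation_on_def)

lemma gauge_op_inv:
  assumes "gauge_fock_space M" "g \<in> carrier (gauge_group M)"
  shows "gauge_op M (inv\<^bsub>gauge_group M\<^esub> g) (gauge_op M g \<psi>) = \<psi>"
  using assms
  by (metis gauge_fock_space_group gauge_op_mult gauge_op_one group.inv_closed group.l_inv)

text \<open>The charge is a gauge-invariant observable, hence commutes with
  \<open>gauge_op M g\<close> on its domain.\<close>

lemma gauge_op_sector:
  assumes "gauge_fock_space M" "g \<in> carrier (gauge_group M)" "\<psi> \<in> sector M Q"
  shows "gauge_op M g \<psi> \<in> sector M Q"
proof -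
  have "gauge_op M g \<psi> \<in> charge_dom M" "charge M (gauge_op M g \<psi>) = gauge_op M g (charge M \<psi>)"
    using assms by (simp_all add: gauge_fock_space_def gauge_invariant_observable_def sector_def)
  then show ?thesis
    using assms gauge_op_clinear[OF assms(1,2)] by (simp add: sector_def clinear_on_def)
qed

text \<open>The algebraic span of an orbit supplies the representation in which a superposition
  transforms.\<close>

lemma representation_on_orbit_span:
  fixes \<psi> :: "'h::complex_hilbert_space"
  assumes M: "gauge_fock_space M"
  defines "V \<equiv> cspan {gauge_op M g \<psi> | g. g \<in> carrier (gauge_group M)}"
  shows "representation_on (gauge_group M) (gauge_op M) V"
  unfolding representation_on_def
proof (intro conjI ballI)
  show V: "csubspace V" by (simp add: V_def)
  fix g assume g: "g \<in> carrier (gauge_group M)"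
  note lin = gauge_op_clinear[OF M g]
  show "clinear_on V (gauge_op M g)"
    using lin by (simp add: clinear_on_def)
  \<comment> \<open>Invariance by minimality of the span: the preimage of \<open>V\<close> is a
    subspace, and it contains the orbit because applying \<open>g\<close> after \<open>h\<close> is
    applying their product.\<close>
  have "csubspace (gauge_op M g -` V)"
    using lin clinear_on_zero[OF lin] V
    by (auto intro!: complex_vector.subspaceI
        simp: clinear_on_def complex_vector.subspace_0 complex_vector.subspace_add
          complex_vector.subspace_scale)
  moreover have "gauge_op M g (gauge_op M h \<psi>) \<in> V" if "h \<in> carrier (gauge_group M)" for h
    using that g gauge_op_mult[OF M g that]
      monoid.m_closed[OF group.is_monoid[OF gauge_fock_space_group[OF M]] g that]
    unfolding V_def by (metis (mono_tags, lifting) complex_vector.span_base mem_Collect_eq)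
  ultimately have "V \<subseteq> gauge_op M g -` V"
    by (subst V_def, intro complex_vector.span_minimal) auto
  then show "gauge_op M g ` V \<subseteq> V" by blast
qed (use gauge_op_one[OF M] gauge_op_mult[OF M] in auto)


section \<open>Covariance of products of creation operators and irreducibility of operator
  blocks\<close>

section \<open>Packaged operators\<close>

lemma create_clinear:
  "gauge_fock_space M \<Longrightarrow> x \<in> labels M \<Longrightarrow> clinear_on (fock_core M) (create M x)"
  by (simp add: gauge_fock_space_def)

lemma transforms_irreducibly_finite:
  "transforms_irreducibly M s p D \<Longrightarrow> finite (iqn M s)"
  by (simp add: transforms_irreducibly_def irreducible_representation_def)

text \<open>The conjugation law evaluated at \<open>gauge_op M g \<phi>\<close>, where the inverse
  cancels. This form pushes a gauge transformation past one creation operator.\<close>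

lemma transforms_irreducibly_create:
  assumes "gauge_fock_space M" "transforms_irreducibly M s p D" "g \<in> carrier (gauge_group M)"
    "q \<in> iqn M s" "\<phi> \<in> fock_core M"
  shows "gauge_op M g (create M (s, p, q) \<phi>) =
    (\<Sum>q'\<in>iqn M s. D g q' q *\<^sub>C create M (s, p, q') (gauge_op M g \<phi>))"
proof -
  have "gauge_op M g (create M (s, p, q)
      (gauge_op M (inv\<^bsub>gauge_group M\<^esub> g) (gauge_op M g \<phi>))) =
    (\<Sum>q'\<in>iqn M s. D g q' q *\<^sub>C create M (s, p, q') (gauge_op M g \<phi>))"
    using assms(2-4) gauge_op_fock_core[OF assms(1,3,5)]
    by (simp add: transforms_irreducibly_def)
  then show ?thesis by (simp add: gauge_op_inv[OF assms(1,3)])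
qed

lemma finite_listset: "(\<And>A. A \<in> set As \<Longrightarrow> finite A) \<Longrightarrow> finite (listset As)"
proof (induction As)
  case (Cons A As)
  have "listset (A # As) = (\<lambda>(x, xs). x # xs) ` (A \<times> listset As)"
    by (auto simp: set_Cons_def)
  then show ?case using Cons by simp
qed simp

text \<open>Splits off the internal index of the first operator, in step with the recursion of
  \<open>fock_state\<close>.\<close>

lemma sum_listset_Cons:
  "(\<Sum>ys\<in>listset (A # As). f ys) = (\<Sum>x\<in>A. \<Sum>xs\<in>listset As. f (x # xs))"
proof -
  have "listset (A # As) = (\<lambda>(x, xs). x # xs) ` (A \<times> listset As)"
    by (auto simp: set_Cons_def)
  moreover have "inj_on (\<lambda>(x, xs). x # xs) (A \<times> listset As)"
    by (auto simp: inj_on_def)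
  ultimately show ?thesis
    by (simp add: sum.reindex sum.cartesian_product case_prod_unfold)
qed

lemma map2_multiplet_in_labels:
  "qs \<in> listset (map (\<lambda>x. iqn M (fst x)) xs)
    \<Longrightarrow> set (map2 (\<lambda>(s, p, _) q. (s, p, q)) xs qs) \<subseteq> labels M"
proof (induction xs arbitrary: qs)
  case (Cons x xs)
  then obtain q qs' where "qs = q # qs'" "q \<in> iqn M (fst x)"
    "qs' \<in> listset (map (\<lambda>x. iqn M (fst x)) xs)"
    by (auto simp: set_Cons_def)
  with Cons.IH show ?case by (auto simp: labels_def split: prod.splits)
qed simp

lemma gauge_op_fock_state:
  fixes D :: "nat \<Rightarrow> 'g \<Rightarrow> 'q \<Rightarrow> 'q \<Rightarrow> complex"
    and M :: "('g, 'h::complex_hilbert_space, 's, 'p, 'q) gauge_fock"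
  assumes M: "gauge_fock_space M" and g: "g \<in> carrier (gauge_group M)"
    and "set xs \<subseteq> labels M"
    and "\<And>k. k < length xs \<Longrightarrow>
      transforms_irreducibly M (fst (xs ! k)) (fst (snd (xs ! k))) (D k)"
  shows "gauge_op M g (fock_state M xs) =
    (\<Sum>qs\<in>listset (map (\<lambda>x. iqn M (fst x)) xs).
      (\<Prod>k<length xs. D k g (qs ! k) (snd (snd (xs ! k)))) *\<^sub>C
      fock_state M (map2 (\<lambda>(s, p, _) q. (s, p, q)) xs qs))"
  using assms(3,4)
\<comment> \<open>\<open>D\<close> is generalized because the tail of the list uses the shifted
  family \<open>D (Suc k)\<close>. The base case is invariance of the vacuum.\<close>
proof (induction xs arbitrary: D)
  case Nil
  show ?case using M g by (simp add: fock_state_def gauge_fock_space_def)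
next
  case (Cons x xs)
  obtain s p q where x: "x = (s, p, q)" by (cases x)
  let ?L = "listset (map (\<lambda>x. iqn M (fst x)) xs)"
  let ?c = "\<lambda>qs. \<Prod>k<length xs. D (Suc k) g (qs ! k) (snd (snd (xs ! k)))"
  let ?f = "\<lambda>qs. fock_state M (map2 (\<lambda>(s, p, _) q. (s, p, q)) xs qs)"
  have q: "q \<in> iqn M s" and xs: "set xs \<subseteq> labels M"
    using Cons.prems(1) by (auto simp: x labels_def)
  have D0: "transforms_irreducibly M s p (D 0)"
    using Cons.prems(2)[of 0] by (simp add: x)
  have DS: "transforms_irreducibly M (fst (xs ! k)) (fst (snd (xs ! k))) (D (Suc k))"
    if "k < length xs" for k
    using Cons.prems(2)[of "Suc k"] that by simp
  have fin: "finite ?L"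
    using DS transforms_irreducibly_finite
    by (intro finite_listset) (fastforce simp: in_set_conv_nth)
  have "gauge_op M g (fock_state M (x # xs)) =
      gauge_op M g (create M (s, p, q) (fock_state M xs))"
    by (simp add: fock_state_def x)
  also have "\<dots> = (\<Sum>q'\<in>iqn M s. D 0 g q' q *\<^sub>C create M (s, p, q') (gauge_op M g (fock_state M xs)))"
    by (rule transforms_irreducibly_create[OF M D0 g q fock_state_in_fock_core[OF xs]])
  also have "\<dots> = (\<Sum>q'\<in>iqn M s. D 0 g q' q *\<^sub>C create M (s, p, q') (\<Sum>qs\<in>?L. ?c qs *\<^sub>C ?f qs))"
    using Cons.IH[OF xs DS] by simp
  also have "\<dots> = (\<Sum>q'\<in>iqn M s. D 0 g q' q *\<^sub>C (\<Sum>qs\<in>?L. ?c qs *\<^sub>C create M (s, p, q') (?f qs)))"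
  \<comment> \<open>Creation operators are linear only on \<open>fock_core M\<close>; the terms stay
    there because changing internal states within a multiplet gives valid labels again.\<close>
  proof (rule sum.cong[OF refl])
    fix q' assume "q' \<in> iqn M s"
    then have "clinear_on (fock_core M) (create M (s, p, q'))"
      using create_clinear[OF M] by (simp add: labels_def)
    then have "create M (s, p, q') (\<Sum>qs\<in>?L. ?c qs *\<^sub>C ?f qs) =
        (\<Sum>qs\<in>?L. ?c qs *\<^sub>C create M (s, p, q') (?f qs))"
      by (rule clinear_on_sum[OF _ csubspace_fock_core fin])
        (rule fock_state_in_fock_core[OF map2_multiplet_in_labels])
    then show "D 0 g q' q *\<^sub>C create M (s, p, q') (\<Sum>qs\<in>?L. ?c qs *\<^sub>C ?f qs) =
        D 0 g q' q *\<^sub>C (\<Sum>qs\<in>?L. ?c qs *\<^sub>C create M (s, p, q') (?f qs))" by (rule arg_cong)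
  qed
  also have "\<dots> = (\<Sum>q'\<in>iqn M s. \<Sum>qs\<in>?L. (D 0 g q' q * ?c qs) *\<^sub>C create M (s, p, q') (?f qs))"
    by (simp add: complex_vector.scale_sum_right)
  also have "\<dots> = (\<Sum>qs\<in>listset (map (\<lambda>x. iqn M (fst x)) (x # xs)).
      (\<Prod>k<length (x # xs). D k g (qs ! k) (snd (snd ((x # xs) ! k)))) *\<^sub>C
      fock_state M (map2 (\<lambda>(s, p, _) q. (s, p, q)) (x # xs) qs))"
    \<comment> \<open>The pair of \<open>q'\<close> and \<open>qs\<close> is the list
      \<open>q' # qs\<close>, and \<open>D 0 g q' q\<close> becomes the factor at index 0 of the
      product.\<close>
    unfolding list.map sum_listset_Cons
    by (simp add: x prod.lessThan_Suc_shift fock_state_def del: prod.lessThan_Suc listset.simps)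
  finally show ?case .
qed

lemma packaged_transforms_covariantly:
  assumes M: "gauge_fock_space M" and xs: "\<And>x. x \<in> set xs \<Longrightarrow> packaged_operator M x"
  shows "transforms_covariantly M xs"
proof -
  \<comment> \<open>The bound on \<open>k\<close> sits inside the existential so that one choice
    function covers all positions.\<close>
  have "\<forall>k. \<exists>D. k < length xs \<longrightarrow>
      transforms_irreducibly M (fst (xs ! k)) (fst (snd (xs ! k))) D"
    using xs by (auto simp: packaged_operator_def)
  then obtain D where D: "\<And>k. k < length xs \<Longrightarrow>
      transforms_irreducibly M (fst (xs ! k)) (fst (snd (xs ! k))) (D k)"
    by metis
  have "set xs \<subseteq> labels M" using xs by (auto simp: packaged_operator_def)
  with gauge_op_fock_state[OF M _ this D] D show ?thesis
    unfolding transforms_covariantly_def by blast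
qed

text \<open>The intertwining property: conjugating a block of operators is the matrix action on its
  coefficients.\<close>

lemma block_op_mat_apply:
  assumes M: "gauge_fock_space M" and D: "transforms_irreducibly M s p D"
    and g: "g \<in> carrier (gauge_group M)"
  shows "(\<lambda>\<phi>\<in>fock_core M.
      gauge_op M g (block_op M s p v (gauge_op M (inv\<^bsub>gauge_group M\<^esub> g) \<phi>))) =
    block_op M s p (mat_apply (iqn M s) (D g) v)"
proof (rule ext)
  fix \<phi>
  let ?B = "iqn M s"
  let ?h = "inv\<^bsub>gauge_group M\<^esub> g"
  show "(\<lambda>\<phi>\<in>fock_core M. gauge_op M g (block_op M s p v (gauge_op M ?h \<phi>))) \<phi> =
      block_op M s p (mat_apply ?B (D g) v) \<phi>"
  proof (cases "\<phi> \<in> fock_core M")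
    case True
    note fin = transforms_irreducibly_finite[OF D]
    have h: "gauge_op M ?h \<phi> \<in> fock_core M"
      by (rule gauge_op_fock_core[OF M group.inv_closed[OF gauge_fock_space_group[OF M] g] True])
    have "gauge_op M g (block_op M s p v (gauge_op M ?h \<phi>)) =
        (\<Sum>q\<in>?B. v q *\<^sub>C gauge_op M g (create M (s, p, q) (gauge_op M ?h \<phi>)))"
      using h by (simp add: block_op_def gauge_op_sum[OF M g fin])
    also have "\<dots> = (\<Sum>q\<in>?B. v q *\<^sub>C (\<Sum>q'\<in>?B. D g q' q *\<^sub>C create M (s, p, q') \<phi>))"
      using D g True by (simp add: transforms_irreducibly_def)
    also have "\<dots> = (\<Sum>q\<in>?B. \<Sum>q'\<in>?B. (D g q' q * v q) *\<^sub>C create M (s, p, q') \<phi>)"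
      by (simp add: complex_vector.scale_sum_right mult.commute)
    also have "\<dots> = (\<Sum>q'\<in>?B. (\<Sum>q\<in>?B. D g q' q * v q) *\<^sub>C create M (s, p, q') \<phi>)"
      by (subst sum.swap) (simp add: complex_vector.scale_sum_left)
    also have "\<dots> = block_op M s p (mat_apply ?B (D g) v) \<phi>"
      using True by (simp add: block_op_def mat_apply_def)
    finally show ?thesis using True by simp
  \<comment> \<open>Off the core both extensional functions are \<open>undefined\<close>.\<close>
  qed (simp add: block_op_def)
qed

text \<open>An invariant space of operators is pulled back to an invariant space of coefficient
  vectors, where irreducibility of \<open>D\<close> applies.\<close>

lemma packaged_indivisible_block:
  assumes M: "gauge_fock_space M" and D: "transforms_irreducibly M s p D"
  shows "indivisible_block M s p"
  unfolding indivisible_block_def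
proof (intro allI impI, elim conjE)
  fix W
  assume W: "W \<subseteq> range (block_op M s p)" and sub: "op_subspace M W"
    and inv: "\<forall>g\<in>carrier (gauge_group M). \<forall>A\<in>W. (\<lambda>\<phi>\<in>fock_core M.
      gauge_op M g (A (gauge_op M (inv\<^bsub>gauge_group M\<^esub> g) \<phi>))) \<in> W"
  let ?B = "iqn M s"
  \<comment> \<open>\<open>block_op\<close> reads coefficients only on \<open>?B\<close>, so
    truncating to \<open>coord_space ?B\<close> changes no operator. Hence every element of
    \<open>W\<close> comes from some vector in \<open>X\<close>.\<close>
  let ?res = "\<lambda>v q. if q \<in> ?B then v q else (0::complex)"
  define X where "X = {v \<in> coord_space ?B. block_op M s p v \<in> W}"
  have zero: "block_op M s p (\<lambda>i. 0) = (\<lambda>\<phi>\<in>fock_core M. 0)"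
    by (simp add: block_op_def)
  have add: "block_op M s p (\<lambda>i. v i + w i) =
      (\<lambda>\<phi>\<in>fock_core M. block_op M s p v \<phi> + block_op M s p w \<phi>)" for v w
    by (auto simp: block_op_def scaleC_add_left sum.distrib)
  have scale: "block_op M s p (\<lambda>i. c * v i) =
      (\<lambda>\<phi>\<in>fock_core M. c *\<^sub>C block_op M s p v \<phi>)" for c v
    by (auto simp: block_op_def complex_vector.scale_sum_right)
  have res: "block_op M s p (?res v) = block_op M s p v" "?res v \<in> coord_space ?B" for v
    by (auto simp: block_op_def coord_space_def intro!: sum.cong)
  have X: "coord_subspace X"
    using sub by (auto simp: coord_subspace_def X_def coord_space_def zero add scale op_subspace_def)
  have "mat_apply ?B (D g) v \<in> X" if "g \<in> carrier (gauge_group M)" "v \<in> X" for g v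
  proof -
    have "block_op M s p v \<in> W" using that(2) by (simp add: X_def)
    then have "block_op M s p (mat_apply ?B (D g) v) \<in> W"
      using inv that(1) block_op_mat_apply[OF M D that(1), of v] by metis
    then show ?thesis by (simp add: X_def coord_space_def mat_apply_def)
  qed
  moreover have "X \<subseteq> coord_space ?B" by (auto simp: X_def)
  ultimately have "X = {\<lambda>i. 0} \<or> X = coord_space ?B"
    using X D unfolding transforms_irreducibly_def irreducible_representation_def by blast
  then show "W = {\<lambda>\<phi>\<in>fock_core M. 0} \<or> W = range (block_op M s p)"
  proof
    assume X0: "X = {\<lambda>i. 0}"
    have "A = (\<lambda>\<phi>\<in>fock_core M. 0)" if "A \<in> W" for A
    proof -
      from subsetD[OF W that] obtain v where v: "A = block_op M s p v" by (rule rangeE)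
      then have "?res v \<in> X" using that res by (simp add: X_def)
      then have "?res v = (\<lambda>i. 0)" using X0 by simp
      then show ?thesis using res(1)[of v] zero v by simp
    qed
    then show ?thesis using sub by (auto simp: op_subspace_def)
  next
    assume X1: "X = coord_space ?B"
    have "block_op M s p v \<in> W" for v
    proof -
      have "?res v \<in> X" using res(2) unfolding X1 .
      then have "block_op M s p (?res v) \<in> W" by (simp add: X_def)
      then show ?thesis by (simp only: res(1))
    qed
    then have "range (block_op M s p) \<subseteq> W" by (rule image_subsetI)
    with W show ?thesis by (intro disjI2 subset_antisym)
  qed
qed


section \<open>Convergent superpositions of packaged basis states of one charge\<close>

section \<open>Superpositions within a sector\<close>

theorem theorem2:
  fixes M :: "('g, 'h::complex_hilbert_space, 's, 'p, 'q) gauge_fock"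
    and Q :: real
    and I :: "nat set"
    and \<alpha> :: "nat \<Rightarrow> complex"
    and xs :: "nat \<Rightarrow> ('s \<times> 'p \<times> 'q) list"
    and \<Theta> :: "nat \<Rightarrow> 'h"
    and \<Psi> :: 'h
  assumes "gauge_fock_space M"
    and "\<And>n. n \<in> I \<Longrightarrow> packaged_basis_state M Q (xs n)"
    and "\<And>n. n \<in> I \<Longrightarrow> \<Theta> n = fock_state M (xs n)"
    and "((\<lambda>n. \<alpha> n *\<^sub>C \<Theta> n) has_sum \<Psi>) I"
  shows
    "(\<comment> \<open>superselection compatibility\<close>
       \<Psi> \<in> sector M Q \<and>
       (\<Psi> \<noteq> 0 \<longrightarrow> physically_realizable M \<Psi>) \<and>
       (\<forall>Q' \<xi>. Q' \<noteq> Q \<and> \<xi> \<in> sector M Q' \<longrightarrow>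
          \<not> interferes M \<xi> \<Psi> \<and> \<not> interferes M \<Psi> \<xi>) \<and>
       (\<forall>Q\<^sub>1 Q\<^sub>2 \<phi>\<^sub>1 \<phi>\<^sub>2 c\<^sub>1 c\<^sub>2.
          Q\<^sub>1 \<noteq> Q\<^sub>2 \<and> \<phi>\<^sub>1 \<in> sector M Q\<^sub>1 \<and> \<phi>\<^sub>2 \<in> sector M Q\<^sub>2 \<and>
          \<phi>\<^sub>1 \<noteq> 0 \<and> \<phi>\<^sub>2 \<noteq> 0 \<and> c\<^sub>1 \<noteq> 0 \<and> c\<^sub>2 \<noteq> 0 \<longrightarrow>
          \<not> physically_realizable M (c\<^sub>1 *\<^sub>C \<phi>\<^sub>1 + c\<^sub>2 *\<^sub>C \<phi>\<^sub>2))) \<and>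
     (\<comment> \<open>packaged entangled state\<close>
       \<not> factorizable M \<Psi> \<longrightarrow> packaged_entangled M \<Psi>) \<and>
     (\<comment> \<open>gauge covariance\<close>
       (\<forall>n\<in>I. transforms_covariantly M (xs n) \<and>
          (\<forall>g\<in>carrier (gauge_group M). gauge_op M g (\<Theta> n) \<in> sector M Q)) \<and>
       (\<forall>g\<in>carrier (gauge_group M).
          ((\<lambda>n. \<alpha> n *\<^sub>C gauge_op M g (\<Theta> n)) has_sum gauge_op M g \<Psi>) I) \<and>
       (let V = cspan {gauge_op M g \<Psi> | g. g \<in> carrier (gauge_group M)} in
          \<Psi> \<in> V \<and> V \<subseteq> sector M Q \<and>
          representation_on (gauge_group M) (gauge_op M) V) \<and>
       (\<forall>n\<in>I. \<forall>x\<in>set (xs n). indivisible_block M (fst x) (fst (snd x))))"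
proof -
  note M = assms(1)
  note sa = gauge_fock_space_self_adjoint[OF M]
  have packaged: "packaged_operator M x" if "n \<in> I" "x \<in> set (xs n)" for n x
    using assms(2)[OF that(1)] that(2) by (simp add: packaged_basis_state_def)
  have \<Theta>: "\<Theta> n \<in> sector M Q" if "n \<in> I" for n
    using assms(2,3)[OF that] by (simp add: packaged_basis_state_def)
  \<comment> \<open>The sum may be infinite, so closedness of the sector is needed besides
    linearity.\<close>
  have \<Psi>: "\<Psi> \<in> sector M Q"
    using \<Theta> complex_vector.subspace_scale[OF csubspace_sector[OF sa]]
    by (intro has_sum_in_closed_csubspace[OF csubspace_sector[OF sa] closed_sector[OF sa] assms(4)])
      blast
  \<comment> \<open>Nonzero coefficients are absorbed: the rescaled vectors are nonzero and stay in
    their sectors.\<close>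
  have mixture: "\<not> physically_realizable M (c\<^sub>1 *\<^sub>C \<phi>\<^sub>1 + c\<^sub>2 *\<^sub>C \<phi>\<^sub>2)"
    if "Q\<^sub>1 \<noteq> Q\<^sub>2 \<and> \<phi>\<^sub>1 \<in> sector M Q\<^sub>1 \<and> \<phi>\<^sub>2 \<in> sector M Q\<^sub>2 \<and>
      \<phi>\<^sub>1 \<noteq> 0 \<and> \<phi>\<^sub>2 \<noteq> 0 \<and> c\<^sub>1 \<noteq> 0 \<and> c\<^sub>2 \<noteq> 0" for Q\<^sub>1 Q\<^sub>2 \<phi>\<^sub>1 \<phi>\<^sub>2 c\<^sub>1 c\<^sub>2
    using that complex_vector.subspace_scale[OF csubspace_sector[OF sa]]
    by (intro not_physically_realizable_mixture[OF M, of _ Q\<^sub>1 _ Q\<^sub>2]) auto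
  \<comment> \<open>The given expansion, with \<Theta> written out as Fock states, is the
    witness.\<close>
  have entangled: "packaged_entangled M \<Psi>" if "\<not> factorizable M \<Psi>"
  proof -
    have "((\<lambda>n. \<alpha> n *\<^sub>C fock_state M (xs n)) has_sum \<Psi>) I"
      using assms(4) by (rule has_sum_cong[THEN iffD1, rotated]) (simp add: assms(3))
    with that assms(2) show ?thesis unfolding packaged_entangled_def by blast
  qed
  have sum: "((\<lambda>n. \<alpha> n *\<^sub>C gauge_op M g (\<Theta> n)) has_sum gauge_op M g \<Psi>) I"
    if g: "g \<in> carrier (gauge_group M)" for g
    using has_sum_bounded_linear[OF unitary_operator_bounded_linear[OF gauge_op_unitary[OF M g]] assms(4)]
      gauge_op_clinear[OF M g]
    by (simp add: clinear_on_def o_def)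
  let ?V = "cspan {gauge_op M g \<Psi> | g. g \<in> carrier (gauge_group M)}"
  \<comment> \<open>The unit of the group puts \<Psi> into its own orbit.\<close>
  have "gauge_op M \<one>\<^bsub>gauge_group M\<^esub> \<Psi> \<in> ?V"
    using monoid.one_closed[OF group.is_monoid[OF gauge_fock_space_group[OF M]]]
    by (intro complex_vector.span_base) blast
  then have "\<Psi> \<in> ?V" by (simp add: gauge_op_one[OF M])
  moreover have "?V \<subseteq> sector M Q"
    using gauge_op_sector[OF M _ \<Psi>]
    by (intro complex_vector.span_minimal csubspace_sector[OF sa]) blast
  ultimately have V: "let V = ?V in \<Psi> \<in> V \<and> V \<subseteq> sector M Q \<and>
      representation_on (gauge_group M) (gauge_op M) V"
    using representation_on_orbit_span[OF M] by simp
  have block: "indivisible_block M (fst x) (fst (snd x))" if "n \<in> I" "x \<in> set (xs n)" for n x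
    using packaged[OF that] packaged_indivisible_block[OF M] by (auto simp: packaged_operator_def)
  have covariant: "transforms_covariantly M (xs n)" if "n \<in> I" for n
    by (rule packaged_transforms_covariantly[OF M packaged[OF that]])
  show ?thesis
  proof (intro conjI)
    show "\<forall>Q' \<xi>. Q' \<noteq> Q \<and> \<xi> \<in> sector M Q' \<longrightarrow> \<not> interferes M \<xi> \<Psi> \<and> \<not> interferes M \<Psi> \<xi>"
      using not_interferes_sectors[OF M] \<Psi> by metis
    show "\<forall>n\<in>I. transforms_covariantly M (xs n) \<and>
        (\<forall>g\<in>carrier (gauge_group M). gauge_op M g (\<Theta> n) \<in> sector M Q)"
      by (simp add: covariant gauge_op_sector[OF M _ \<Theta>])
    show "\<Psi> \<noteq> 0 \<longrightarrow> physically_realizable M \<Psi>"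
      using physically_realizable_sector[OF sa \<Psi>] by simp
  qed (intro \<Psi> mixture entangled sum V block allI impI ballI; assumption)+
qed

end
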